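(* Let $M=(E,\mathcal{I})$ be a matroid on a finite ground set $E$, given by an independence oracle, and let $w\colon E\to\mathbb{R}$ be a weight function. Then a minimum-cardinality forcing set for minimum weight bases of $(M,w)$ can be computed in polynomial time (polynomially many oracle calls and polynomial additional time). Similarly, a minimum-cardinality anti-forcing set for minimum weight bases of $(M,w)$ can be computed in polynomial time.
   Context: An independence oracle answers, for a queried $X\subseteq E$, whether $X\in\mathcal{I}$. Let $\mathcal{B}_{\min}(M)$ denote the set of bases $B$ of $M$ minimizing $w(B)=\sum_{e\in B}w(e)$. A set $S\subseteq E$ is a forcing set for $\mathcal{B}_{\min}(M)$ if there is exactly one $B\in\mathcal{B}_{\min}(M)$ with $S\subseteq B$; it is an anti-forcing set for $\mathcal{B}_{\min}(M)$ if there is exactly one $B\in\mathcal{B}_{\min}(M)$ with $S\cap B=\varnothing$. *)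

theory Defs
  imports Complex_Main "HOL-Computational_Algebra.Polynomial"
begin

section \<open>Matroids, minimum weight bases, forcing and anti-forcing sets\<close>

locale matroid =
  fixes E :: "'a set" and indep :: "'a set \<Rightarrow> bool"
  assumes finite_ground: "finite E"
    and indep_subset_ground: "indep X \<Longrightarrow> X \<subseteq> E"
    and indep_empty: "indep {}"
    and indep_subset: "indep X \<Longrightarrow> Y \<subseteq> X \<Longrightarrow> indep Y"
    and augment: "indep X \<Longrightarrow> indep Y \<Longrightarrow> card X < card Y \<Longrightarrow> \<exists>y \<in> Y - X. indep (insert y X)"

definition basis :: "('a set \<Rightarrow> bool) \<Rightarrow> 'a set \<Rightarrow> bool" where
  "basis indep B \<longleftrightarrow> indep B \<and> (\<forall>X. indep X \<longrightarrow> B \<subseteq> X \<longrightarrow> X = B)"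

definition min_weight_bases :: "('a set \<Rightarrow> bool) \<Rightarrow> ('a \<Rightarrow> real) \<Rightarrow> 'a set set" where
  "min_weight_bases indep w = {B. is_arg_min (\<lambda>B. \<Sum>e\<in>B. w e) (basis indep) B}"

definition forcing_set :: "'a set \<Rightarrow> 'a set set \<Rightarrow> 'a set \<Rightarrow> bool" where
  "forcing_set E F S \<longleftrightarrow> S \<subseteq> E \<and> (\<exists>!B. B \<in> F \<and> S \<subseteq> B)"

definition anti_forcing_set :: "'a set \<Rightarrow> 'a set set \<Rightarrow> 'a set \<Rightarrow> bool" where
  "anti_forcing_set E F S \<longleftrightarrow> S \<subseteq> E \<and> (\<exists>!B. B \<in> F \<and> S \<inter> B = {})"

definition min_forcing_set ::
    "'a set \<Rightarrow> ('a set \<Rightarrow> bool) \<Rightarrow> ('a \<Rightarrow> real) \<Rightarrow> 'a set \<Rightarrow> bool" where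
  "min_forcing_set E indep w S \<longleftrightarrow>
     is_arg_min card (forcing_set E (min_weight_bases indep w)) S"

definition min_anti_forcing_set ::
    "'a set \<Rightarrow> ('a set \<Rightarrow> bool) \<Rightarrow> ('a \<Rightarrow> real) \<Rightarrow> 'a set \<Rightarrow> bool" where
  "min_anti_forcing_set E indep w S \<longleftrightarrow>
     is_arg_min card (anti_forcing_set E (min_weight_bases indep w)) S"


section \<open>Random access machines with real weights and a set oracle\<close>

text \<open>
  Programs are structured programs over two infinite random access memories, one holding natural
  numbers and one holding real numbers, together with an oracle tape and an output tape, each of
  which holds a finite set of natural numbers that is written one element at a time.

  Arithmetic has unit cost. There is addition and truncated subtraction but no multiplication on
  natural numbers, so that the bit lengths of numbers grow only linearly with the number of steps,
  and unit cost time is polynomially related to Turing machine time. Real numbers can be added, subtracted and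
  compared; there are no real constants and no conversions such as rounding, so real numbers
  influence the rest of the computation only through the outcomes of comparisons.
\<close>

record state =
  nat_mem :: "nat \<Rightarrow> nat"
  real_mem :: "nat \<Rightarrow> real"
  oracle_tape :: "nat set"
  output_tape :: "nat set"

text \<open>A memory address is either fixed or read from a cell of the natural number memory.\<close>

datatype address = Direct nat | Indirect nat

fun loc :: "state \<Rightarrow> address \<Rightarrow> nat" where
  "loc s (Direct k) = k"
| "loc s (Indirect k) = nat_mem s k"

abbreviation nat_val :: "state \<Rightarrow> address \<Rightarrow> nat" where
  "nat_val s a \<equiv> nat_mem s (loc s a)"

abbreviation real_val :: "state \<Rightarrow> address \<Rightarrow> real" where
  "real_val s a \<equiv> real_mem s (loc s a)"

definition set_nat :: "address \<Rightarrow> nat \<Rightarrow> state \<Rightarrow> state" where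
  "set_nat a v s = s\<lparr>nat_mem := (nat_mem s)(loc s a := v)\<rparr>"

definition set_real :: "address \<Rightarrow> real \<Rightarrow> state \<Rightarrow> state" where
  "set_real a v s = s\<lparr>real_mem := (real_mem s)(loc s a := v)\<rparr>"

datatype instr =
    Skip
  | Const address nat
  | Move address address
  | Add address address address
  | Sub address address address
  | Real_Move address address
  | Real_Add address address address
  | Real_Sub address address address
  | Oracle_Insert address
  | Oracle_Delete address
  | Output_Insert address

fun exec_instr :: "instr \<Rightarrow> state \<Rightarrow> state" where
  "exec_instr Skip s = s"
| "exec_instr (Const a v) s = set_nat a v s"
| "exec_instr (Move a b) s = set_nat a (nat_val s b) s"
| "exec_instr (Add a b c) s = set_nat a (nat_val s b + nat_val s c) s"
| "exec_instr (Sub a b c) s = set_nat a (nat_val s b - nat_val s c) s"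
| "exec_instr (Real_Move a b) s = set_real a (real_val s b) s"
| "exec_instr (Real_Add a b c) s = set_real a (real_val s b + real_val s c) s"
| "exec_instr (Real_Sub a b c) s = set_real a (real_val s b - real_val s c) s"
| "exec_instr (Oracle_Insert a) s = s\<lparr>oracle_tape := insert (nat_val s a) (oracle_tape s)\<rparr>"
| "exec_instr (Oracle_Delete a) s = s\<lparr>oracle_tape := oracle_tape s - {nat_val s a}\<rparr>"
| "exec_instr (Output_Insert a) s = s\<lparr>output_tape := insert (nat_val s a) (output_tape s)\<rparr>"

datatype test = Less address address | Real_Less address address

fun holds :: "test \<Rightarrow> state \<Rightarrow> bool" where
  "holds (Less a b) s \<longleftrightarrow> nat_val s a < nat_val s b"
| "holds (Real_Less a b) s \<longleftrightarrow> real_val s a < real_val s b"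

datatype prog =
    Instr instr
  | Query address
  | Seq prog prog
  | If_Else test prog prog
  | While test prog

text \<open>
  \<open>exec orc c s q t s'\<close>: started in state \<open>s\<close>, the program \<open>c\<close> halts in state \<open>s'\<close> after
  \<open>q\<close> oracle calls and \<open>t\<close> further steps. A query asks the oracle about the current content of
  the oracle tape and writes the answer (1 for yes, 0 for no) to the given cell.
\<close>

inductive exec ::
    "(nat set \<Rightarrow> bool) \<Rightarrow> prog \<Rightarrow> state \<Rightarrow> nat \<Rightarrow> nat \<Rightarrow> state \<Rightarrow> bool"
  for orc :: "nat set \<Rightarrow> bool" where
  Instr: "exec orc (Instr i) s 0 1 (exec_instr i s)"
| Query: "exec orc (Query a) s 1 0 (set_nat a (if orc (oracle_tape s) then 1 else 0) s)"
| Seq: "exec orc c1 s1 q1 t1 s2 \<Longrightarrow> exec orc c2 s2 q2 t2 s3 \<Longrightarrow>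
    exec orc (Seq c1 c2) s1 (q1 + q2) (t1 + t2) s3"
| If_True: "holds b s1 \<Longrightarrow> exec orc c1 s1 q t s2 \<Longrightarrow>
    exec orc (If_Else b c1 c2) s1 q (t + 1) s2"
| If_False: "\<not> holds b s1 \<Longrightarrow> exec orc c2 s1 q t s2 \<Longrightarrow>
    exec orc (If_Else b c1 c2) s1 q (t + 1) s2"
| While_False: "\<not> holds b s \<Longrightarrow> exec orc (While b c) s 0 1 s"
| While_True: "holds b s1 \<Longrightarrow> exec orc c s1 q1 t1 s2 \<Longrightarrow>
    exec orc (While b c) s2 q2 t2 s3 \<Longrightarrow>
    exec orc (While b c) s1 (q1 + q2) (t1 + t2 + 1) s3"

inductive_cases exec_InstrE: "exec orc (Instr i) s q t s'"
inductive_cases exec_QueryE: "exec orc (Query a) s q t s'"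
inductive_cases exec_SeqE: "exec orc (Seq c1 c2) s q t s'"
inductive_cases exec_If_ElseE: "exec orc (If_Else b c1 c2) s q t s'"
inductive_cases exec_WhileE: "exec orc (While b c) s q t s'"

lemma exec_deterministic:
  "exec orc c s q t s' \<Longrightarrow> exec orc c s q' t' s'' \<Longrightarrow> q' = q \<and> t' = t \<and> s'' = s'"
proof (induction arbitrary: q' t' s'' rule: exec.induct)
  case (Instr i s)
  then show ?case by (auto elim: exec_InstrE)
next
  case (Query a s)
  then show ?case by (auto elim: exec_QueryE)
next
  case (Seq c1 s1 q1 t1 s2 c2 q2 t2 s3)
  from Seq.prems obtain q1' t1' s2' q2' t2' where *: "exec orc c1 s1 q1' t1' s2'"
    "exec orc c2 s2' q2' t2' s''" "q' = q1' + q2'" "t' = t1' + t2'"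
    by (auto elim: exec_SeqE)
  from Seq.IH(1)[OF *(1)] Seq.IH(2) * show ?case by simp
next
  case (If_True b s1 c1 q t s2 c2)
  from If_True.prems If_True.hyps obtain t1' where "exec orc c1 s1 q' t1' s''" "t' = t1' + 1"
    by (auto elim: exec_If_ElseE)
  with If_True.IH show ?case by simp
next
  case (If_False b s1 c2 q t s2 c1)
  from If_False.prems If_False.hyps obtain t1' where "exec orc c2 s1 q' t1' s''" "t' = t1' + 1"
    by (auto elim: exec_If_ElseE)
  with If_False.IH show ?case by simp
next
  case (While_False b s c)
  from While_False.prems show ?case
    by (rule exec_WhileE) (use While_False.hyps in simp_all)
next
  case (While_True b s1 c q1 t1 s2 q2 t2 s3)
  from While_True.prems obtain q1' t1' s2' q2' t2' where
    *: "exec orc c s1 q1' t1' s2'" "exec orc (While b c) s2' q2' t2' s''"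
    "q' = q1' + q2'" "t' = t1' + t2' + 1"
    by (rule exec_WhileE) (use While_True.hyps in simp_all)
  from While_True.IH(1)[OF *(1)] While_True.IH(2) * show ?case by simp
qed


section \<open>Polynomial time computation on weighted matroids\<close>

text \<open>
  A weighted matroid is presented by an enumeration \<open>xs\<close> of its ground set: the machine refers to
  the element \<open>xs ! i\<close> by its index \<open>i\<close>. Initially, cell 0 of the natural number memory contains
  the size of the ground set, and the real memory contains the weights.
\<close>

definition indep_oracle :: "('a set \<Rightarrow> bool) \<Rightarrow> 'a list \<Rightarrow> nat set \<Rightarrow> bool" where
  "indep_oracle indep xs I \<longleftrightarrow> I \<subseteq> {..<length xs} \<and> indep ((!) xs ` I)"

definition initial_state :: "('a \<Rightarrow> real) \<Rightarrow> 'a list \<Rightarrow> state" where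
  "initial_state w xs =
     \<lparr>nat_mem = (\<lambda>_. 0)(0 := length xs),
      real_mem = (\<lambda>i. if i < length xs then w (xs ! i) else 0),
      oracle_tape = {}, output_tape = {}\<rparr>"

definition poly_time_computable ::
    "('a set \<Rightarrow> ('a set \<Rightarrow> bool) \<Rightarrow> ('a \<Rightarrow> real) \<Rightarrow> 'a set \<Rightarrow> bool) \<Rightarrow> bool" where
  "poly_time_computable solution \<longleftrightarrow>
     (\<exists>(c :: prog) (P :: nat poly). \<forall>E indep w xs.
        matroid E indep \<longrightarrow> distinct xs \<longrightarrow> set xs = E \<longrightarrow>
        (\<exists>q t s. exec (indep_oracle indep xs) c (initial_state w xs) q t s \<and>
           q \<le> poly P (card E) \<and> t \<le> poly P (card E) \<and>
           output_tape s \<subseteq> {..<length xs} \<and>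
           solution E indep w ((!) xs ` output_tape s)))"

end

theory Submission
  imports Defs
begin

text \<open>
  The minimum weight bases satisfy symmetric exchange. Fix one of them, \<open>B\<close>. An element \<open>e \<in> B\<close>
  missing from another minimum weight basis can be exchanged, so every \<open>S \<subseteq> B\<close> forcing \<open>B\<close> contains
  all such \<open>e\<close>; conversely these elements force \<open>B\<close>. The minimum forcing sets are therefore the sets
  \<open>B - \<Inter>\<F>\<close>, where \<open>\<F>\<close> denotes the family of minimum weight bases, and their cardinality does not
  depend on \<open>B\<close>. Dually, the minimum anti-forcing sets are the sets \<open>\<Union>\<F> - B\<close>. After the greedy
  algorithm has found \<open>B\<close>, both sets can be read off from the pairs \<open>e \<in> B\<close>, \<open>f \<notin> B\<close> such that
  \<open>f\<close> weighs no more than \<open>e\<close> and \<open>B - e + f\<close> is independent.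
\<close>

section \<open>Exchange of minimum weight bases\<close>

context matroid
begin

section \<open>Cardinalities of independent sets and symmetric basis exchange\<close>

lemma finite_indep: "indep X \<Longrightarrow> finite X"
  using finite_ground finite_subset indep_subset_ground by blast

text \<open>Augmentation is repeated, by induction on the deficit \<open>card Y - card X\<close>.
  Keeping \<open>Z\<close> inside \<open>X \<union> Y\<close> makes the lemma usable for rank
  arguments within a given set.\<close>

lemma extend_indep:
  assumes "indep X" "indep Y" "card X \<le> card Y"
  obtains Z where "X \<subseteq> Z" "Z \<subseteq> X \<union> Y" "indep Z" "card Z = card Y"
  using assms
proof (induction "card Y - card X" arbitrary: X thesis)
  case 0
  then show ?case by (metis diff_is_0_eq le_antisym order_refl sup_ge1)
next
  case (Suc k)
  then have "card X < card Y" by simp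
  with Suc.prems augment obtain y where y: "y \<in> Y - X" "indep (insert y X)" by blast
  with Suc.prems finite_indep have card: "card (insert y X) = Suc (card X)" by simp
  show ?case
  proof (rule Suc.hyps(1)[of "insert y X"])
    fix Z assume "insert y X \<subseteq> Z" "Z \<subseteq> insert y X \<union> Y" "indep Z" "card Z = card Y"
    with y show thesis by (intro Suc.prems(1)[of Z]) auto
  qed (use Suc.hyps(2) Suc.prems y card in auto)
qed

lemma basis_indep: "basis indep B \<Longrightarrow> indep B"
  by (simp add: basis_def)

lemma card_le_basis:
  assumes "basis indep B" "indep X"
  shows "card X \<le> card B"
  using assms augment[of B X] by (force simp: basis_def)

lemma basis_iff_card:
  assumes "basis indep B"
  shows "basis indep X \<longleftrightarrow> indep X \<and> card X = card B"
proof
  assume "basis indep X"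
  with assms show "indep X \<and> card X = card B"
    by (simp add: basis_indep card_le_basis le_antisym)
next
  assume X: "indep X \<and> card X = card B"
  have "Y = X" if "indep Y" "X \<subseteq> Y" for Y
    using X that card_le_basis[OF assms] card_seteq[of Y X] finite_indep by metis
  with X show "basis indep X" by (simp add: basis_def)
qed

lemma card_exchange:
  assumes "finite B" "e \<in> B" "f \<notin> B"
  shows "card (insert f (B - {e})) = card B"
  using assms card_Suc_Diff1[of B e] by simp

text \<open>If every exchange failed, \<open>A - {e}\<close> would span \<open>D\<close>, the
  fundamental circuit of \<open>e\<close> in \<open>B\<close> without \<open>e\<close>, but not
  \<open>e\<close> itself. Then \<open>insert e D\<close> would be independent, although it is a
  circuit.\<close>

lemma symmetric_exchange:
  assumes A: "basis indep A" and B: "basis indep B" and e: "e \<in> A - B"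
  shows "\<exists>f \<in> B - A. basis indep (insert f (A - {e})) \<and> basis indep (insert e (B - {f}))"
proof (rule ccontr)
  assume no: "\<not> ?thesis"
  note fin [simp] = finite_indep[OF basis_indep[OF A]] finite_indep[OF basis_indep[OF B]]
  have cAe: "Suc (card (A - {e})) = card A" using e by (intro card_Suc_Diff1) auto
  have iAe: "indep (A - {e})" using A basis_indep indep_subset by blast
  \<comment> \<open>The fundamental circuit of \<open>e\<close> with respect to \<open>B\<close>, without \<open>e\<close>.\<close>
  define D where "D = {f \<in> B. indep (insert e (B - {f}))}"
  have D: "indep D" using indep_subset[OF basis_indep[OF B]] by (simp add: D_def)
  have spanned: "\<not> indep (insert f (A - {e}))" if f: "f \<in> D" "f \<notin> A - {e}" for f
  proof
    assume "indep (insert f (A - {e}))"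
    moreover from f e have "f \<in> B - A" by (auto simp: D_def)
    moreover from f have "indep (insert e (B - {f}))" by (simp add: D_def)
    moreover have "card (insert f (A - {e})) = card A" using f cAe by simp
    moreover have "card (insert e (B - {f})) = card B"
      using e \<open>f \<in> B - A\<close> by (intro card_exchange) auto
    ultimately show False using no A B basis_iff_card by blast
  qed
  \<comment> \<open>\<open>A - {e}\<close> is a largest independent subset of
    \<open>D \<union> (A - {e})\<close>: augmenting it there would add an element of
    \<open>D\<close>, which \<open>spanned\<close> excludes.\<close>
  have bound: "card Z \<le> card (A - {e})" if "indep Z" "Z \<subseteq> D \<union> (A - {e})" for Z
  proof (rule ccontr)
    assume "\<not> card Z \<le> card (A - {e})"
    with augment[OF iAe that(1)] obtain z where "z \<in> Z - (A - {e})" "indep (insert z (A - {e}))"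
      by auto
    with that(2) spanned show False by blast
  qed
  obtain Y where Y: "D \<subseteq> Y" "Y \<subseteq> D \<union> (A - {e})" "indep Y" "card Y = card (A - {e})"
    using extend_indep[OF D iAe] bound[OF D] by blast
  with augment[OF Y(3) basis_indep[OF A]] cAe obtain y where y: "y \<in> A - Y" "indep (insert y Y)"
    by auto
  \<comment> \<open>Any other \<open>y\<close> would lie in \<open>A - {e}\<close> and push
    \<open>Y\<close> above the bound.\<close>
  have "y = e"
  proof (rule ccontr)
    assume "y \<noteq> e"
    with y Y have "card (insert y Y) \<le> card (A - {e})" by (intro bound) auto
    with y Y finite_indep[OF Y(3)] show False by simp
  qed
  with y Y(1) have De: "indep (insert e D)" by (meson indep_subset insert_mono)
  \<comment> \<open>\<open>Z\<close> has the size of \<open>B\<close> and lies in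
    \<open>insert e B\<close>, so it omits exactly one \<open>g\<close> of \<open>B\<close>.
    Independence of \<open>Z\<close> puts \<open>g\<close> into \<open>D\<close>, yet
    \<open>D \<subseteq> Z\<close>.\<close>
  obtain Z where Z: "insert e D \<subseteq> Z" "Z \<subseteq> insert e D \<union> B" "indep Z" "card Z = card B"
    using extend_indep[OF De basis_indep[OF B]] card_le_basis[OF B De] by blast
  from Z(4) e Z(1) finite_indep[OF Z(3)] have "\<not> B \<subseteq> Z"
    by (metis DiffD2 card_subset_eq insert_subset)
  then obtain g where g: "g \<in> B" "g \<notin> Z" by blast
  have "Z = insert e (B - {g})"
    by (rule card_subset_eq) (use Z g e card_exchange[of B g e] D_def in auto)
  with Z g have "g \<in> D" by (auto simp: D_def)
  with Z g show False by auto
qed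

section \<open>Weights and minimum weight bases\<close>

lemma sum_exchange:
  fixes w :: "'a \<Rightarrow> real"
  assumes "finite B" "e \<in> B" "f \<notin> B"
  shows "sum w (insert f (B - {e})) = sum w B - w e + w f"
  using assms by (simp add: sum_diff1)

lemma mem_min_weight_bases:
  "B \<in> min_weight_bases indep w \<longleftrightarrow> basis indep B \<and> (\<forall>A. basis indep A \<longrightarrow> sum w B \<le> sum w A)"
  by (auto simp: min_weight_bases_def is_arg_min_def not_less)

text \<open>The two exchanges change the weights by opposite amounts. Neither basis can become
  lighter, so both changes are zero.\<close>

lemma min_weight_bases_exchange:
  assumes A: "A \<in> min_weight_bases indep w" and B: "B \<in> min_weight_bases indep w"
    and e: "e \<in> A - B"
  obtains f where "f \<in> B - A" "insert f (A - {e}) \<in> min_weight_bases indep w"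
    "insert e (B - {f}) \<in> min_weight_bases indep w"
proof -
  from A B have bases: "basis indep A" "basis indep B" by (auto simp: mem_min_weight_bases)
  with symmetric_exchange e obtain f where f: "f \<in> B - A" and
    ex: "basis indep (insert f (A - {e}))" "basis indep (insert e (B - {f}))" by blast
  have "sum w (insert f (A - {e})) = sum w A - w e + w f"
    "sum w (insert e (B - {f})) = sum w B - w f + w e"
    using bases e f by (auto intro!: sum_exchange finite_indep basis_indep)
  moreover have "sum w A = sum w B" using A B by (meson mem_min_weight_bases antisym)
  moreover have "sum w A \<le> sum w (insert f (A - {e}))" "sum w B \<le> sum w (insert e (B - {f}))"
    using A B ex by (auto simp: mem_min_weight_bases)
  ultimately have "sum w (insert f (A - {e})) = sum w A" "sum w (insert e (B - {f})) = sum w B"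
    by linarith+
  with A B ex f show thesis by (intro that[of f]) (auto simp: mem_min_weight_bases)
qed

text \<open>Any basis \<open>A\<close> can be moved towards \<open>B\<close> by exchanges that never
  increase its weight, so local optimality of \<open>B\<close> is global. This is the criterion that
  the greedy algorithm meets.\<close>

lemma locally_optimal_basis:
  assumes B: "basis indep B"
    and opt: "\<And>e f. e \<in> B \<Longrightarrow> f \<in> E - B \<Longrightarrow> indep (insert f (B - {e})) \<Longrightarrow> w e \<le> w f"
  shows "B \<in> min_weight_bases indep w"
proof -
  have "sum w B \<le> sum w A" if "basis indep A" for A
    using that
  proof (induction "card (A - B)" arbitrary: A rule: less_induct)
    case less
    have fin: "finite A" using basis_indep finite_indep less.prems by blast
    show ?case
    proof (cases "B \<subseteq> A")
      case True
      with B less.prems have "A = B" by (auto simp: basis_def)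
      then show ?thesis by simp
    next
      case False
      then obtain e where e: "e \<in> B - A" by blast
      \<comment> \<open>Both halves are used: the exchange in \<open>B\<close> yields
        \<open>w e \<le> w f\<close> by local optimality, the exchange in \<open>A\<close> yields a
        basis closer to \<open>B\<close>.\<close>
      with symmetric_exchange[OF B less.prems] obtain f where f: "f \<in> A - B"
        and ex: "basis indep (insert f (B - {e}))" "basis indep (insert e (A - {f}))" by blast
      have "f \<in> E" using f less.prems basis_indep indep_subset_ground by blast
      with opt e f ex basis_indep have "w e \<le> w f" by simp
      moreover have "card (insert e (A - {f}) - B) < card (A - B)"
        by (rule psubset_card_mono) (use fin e f in auto)
      then have "sum w B \<le> sum w (insert e (A - {f}))" using less.hyps ex by blast
      moreover have "sum w (insert e (A - {f})) = sum w A - w f + w e"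
        by (rule sum_exchange) (use fin e f in auto)
      ultimately show ?thesis by linarith
    qed
  qed
  with B show ?thesis by (simp add: mem_min_weight_bases)
qed

text \<open>Equal cardinality makes an independent exchange a basis, and its weight only has to be
  compared with that of \<open>B\<close>. One query and one comparison thus decide an
  exchange.\<close>

lemma exchange_min_weight_iff:
  assumes "B \<in> min_weight_bases indep w" "e \<in> B" "f \<notin> B"
  shows "insert f (B - {e}) \<in> min_weight_bases indep w \<longleftrightarrow>
    indep (insert f (B - {e})) \<and> w f \<le> w e"
proof -
  have B: "basis indep B" using assms by (simp add: mem_min_weight_bases)
  then have fin: "finite B" using basis_indep finite_indep by blast
  then have "card (insert f (B - {e})) = card B" using assms by (intro card_exchange)
  then have "basis indep (insert f (B - {e})) \<longleftrightarrow> indep (insert f (B - {e}))"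
    using basis_iff_card[OF B] by simp
  moreover have "insert f (B - {e}) \<in> min_weight_bases indep w \<longleftrightarrow>
      basis indep (insert f (B - {e})) \<and> sum w (insert f (B - {e})) \<le> sum w B"
    using assms(1) by (meson mem_min_weight_bases order_trans)
  ultimately show ?thesis using sum_exchange[OF fin assms(2,3), of w] by auto
qed

lemma min_weight_basis_subset: "B \<in> min_weight_bases indep w \<Longrightarrow> B \<subseteq> E"
  by (simp add: mem_min_weight_bases basis_indep indep_subset_ground)

lemma finite_min_weight_basis: "B \<in> min_weight_bases indep w \<Longrightarrow> finite B"
  using min_weight_basis_subset finite_ground finite_subset by blast

lemma min_weight_basis_eqI:
  assumes "A \<in> min_weight_bases indep w" "B \<in> min_weight_bases indep w" "A \<subseteq> B"
  shows "A = B"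
  using assms by (auto simp: mem_min_weight_bases basis_def)

lemma card_min_weight_basis:
  assumes "A \<in> min_weight_bases indep w" "B \<in> min_weight_bases indep w"
  shows "card A = card B"
proof -
  have "basis indep A" "basis indep B" using assms by (simp_all add: mem_min_weight_bases)
  then show ?thesis using basis_iff_card[of B A] by simp
qed

section \<open>Forcing and anti-forcing sets of the minimum weight bases\<close>

text \<open>An element of \<open>A - S\<close> missing from some minimum weight basis could be
  exchanged out of \<open>A\<close>, giving a second basis that contains \<open>S\<close>.\<close>

lemma forcing_setD:
  assumes S: "forcing_set E (min_weight_bases indep w) S"
  obtains A where "A \<in> min_weight_bases indep w" "A - \<Inter> (min_weight_bases indep w) \<subseteq> S"
proof -
  let ?F = "min_weight_bases indep w"
  from S obtain A where A: "A \<in> ?F" "S \<subseteq> A" and uniq: "\<And>B. B \<in> ?F \<Longrightarrow> S \<subseteq> B \<Longrightarrow> B = A"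
    unfolding forcing_set_def by blast
  have "e \<in> S" if e: "e \<in> A" "B \<in> ?F" "e \<notin> B" for e B
  proof (rule ccontr)
    assume "e \<notin> S"
    from min_weight_bases_exchange[OF A(1) e(2), of e] e obtain f
      where "f \<in> B - A" "insert f (A - {e}) \<in> ?F" by auto
    with uniq[of "insert f (A - {e})"] A \<open>e \<notin> S\<close> show False by auto
  qed
  with A that show thesis by blast
qed

text \<open>Dually, an element outside \<open>A\<close> and \<open>S\<close> that some minimum
  weight basis contains could be exchanged into \<open>A\<close>, giving a second basis that avoids
  \<open>S\<close>.\<close>

lemma anti_forcing_setD:
  assumes S: "anti_forcing_set E (min_weight_bases indep w) S"
  obtains A where "A \<in> min_weight_bases indep w" "\<Union> (min_weight_bases indep w) - A \<subseteq> S"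
proof -
  let ?F = "min_weight_bases indep w"
  from S obtain A where A: "A \<in> ?F" "S \<inter> A = {}"
    and uniq: "\<And>B. B \<in> ?F \<Longrightarrow> S \<inter> B = {} \<Longrightarrow> B = A"
    unfolding anti_forcing_set_def by (metis (no_types, lifting))
  have "f \<in> S" if f: "f \<in> B" "B \<in> ?F" "f \<notin> A" for f B
  proof (rule ccontr)
    assume "f \<notin> S"
    from min_weight_bases_exchange[OF f(2) A(1), of f] f obtain e
      where "e \<in> A - B" "insert f (A - {e}) \<in> ?F" by auto
    with uniq[of "insert f (A - {e})"] A \<open>f \<notin> S\<close> f show False by auto
  qed
  with A that show thesis by blast
qed

text \<open>A minimum weight basis containing \<open>B - \<Inter> ?F\<close> also contains
  \<open>\<Inter> ?F\<close>, hence \<open>B\<close>, and so equals \<open>B\<close>. For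
  minimality, another forcing set may force a different basis \<open>A\<close>, so the comparison is
  by cardinality only.\<close>

lemma min_forcing_set_min_weight_basis:
  assumes B: "B \<in> min_weight_bases indep w"
  shows "min_forcing_set E indep w (B - \<Inter> (min_weight_bases indep w))"
proof -
  let ?F = "min_weight_bases indep w"
  have "A = B" if "A \<in> ?F" "B - \<Inter> ?F \<subseteq> A" for A
  proof -
    have "B \<subseteq> A" using Diff_subset_conv Inter_lower[OF that(1)] that(2) by (metis Un_absorb1)
    then show ?thesis using min_weight_basis_eqI[OF B that(1)] by simp
  qed
  with B min_weight_basis_subset[OF B] have "forcing_set E ?F (B - \<Inter> ?F)"
    unfolding forcing_set_def by (intro conjI ex1I[of _ B]) (simp_all add: subset_trans[OF Diff_subset])
  moreover have "card (B - \<Inter> ?F) \<le> card S" if S: "forcing_set E ?F S" for S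
  proof -
    obtain A where A: "A \<in> ?F" "A - \<Inter> ?F \<subseteq> S" using forcing_setD[OF S] .
    have fin: "finite A" "finite B" "finite S"
      using A(1) B S finite_ground finite_subset
      by (auto simp: forcing_set_def finite_min_weight_basis)
    have sub: "\<Inter> ?F \<subseteq> A" "\<Inter> ?F \<subseteq> B" using A(1) B by (simp_all add: Inter_lower)
    with fin have "finite (\<Inter> ?F)" using finite_subset by blast
    \<comment> \<open>Minimum weight bases are equicardinal and all contain
      \<open>\<Inter> ?F\<close>, so the size of the difference does not depend on the
      basis.\<close>
    with sub have "card (B - \<Inter> ?F) = card (A - \<Inter> ?F)"
      using card_min_weight_basis[OF A(1) B] card_Diff_subset by metis
    also have "\<dots> \<le> card S" using A(2) fin by (simp only: card_mono)
    finally show ?thesis .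
  qed
  ultimately show ?thesis
    by (simp add: min_forcing_set_def is_arg_min_def not_less)
qed

text \<open>A minimum weight basis avoiding \<open>\<Union> ?F - B\<close> lies inside
  \<open>B\<close> and so equals \<open>B\<close>. Minimality again follows because
  \<open>\<Union> ?F - A\<close> has the same size for every \<open>A\<close> in the family.\<close>

lemma min_anti_forcing_set_min_weight_basis:
  assumes B: "B \<in> min_weight_bases indep w"
  shows "min_anti_forcing_set E indep w (\<Union> (min_weight_bases indep w) - B)"
proof -
  let ?F = "min_weight_bases indep w"
  have "A = B" if "A \<in> ?F" "(\<Union> ?F - B) \<inter> A = {}" for A
  proof -
    have "A \<subseteq> B" using Union_upper[OF that(1)] that(2) by auto
    then show ?thesis using min_weight_basis_eqI[OF that(1) B] by simp
  qed
  moreover have "\<Union> ?F - B \<subseteq> E" using min_weight_basis_subset by auto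
  ultimately have "anti_forcing_set E ?F (\<Union> ?F - B)"
    using B unfolding anti_forcing_set_def
    by (intro conjI ex1I[of _ B]) (simp_all add: Diff_disjoint[THEN trans[OF Int_commute]])
  moreover have "card (\<Union> ?F - B) \<le> card S" if S: "anti_forcing_set E ?F S" for S
  proof -
    obtain A where A: "A \<in> ?F" "\<Union> ?F - A \<subseteq> S" using anti_forcing_setD[OF S] .
    have fin: "finite A" "finite B" "finite S"
      using A(1) B S finite_ground finite_subset
      by (auto simp: anti_forcing_set_def finite_min_weight_basis)
    have sub: "A \<subseteq> \<Union> ?F" "B \<subseteq> \<Union> ?F" using A(1) B by (simp_all add: Union_upper)
    with fin have "card (\<Union> ?F - B) = card (\<Union> ?F - A)"
      using card_min_weight_basis[OF A(1) B] card_Diff_subset by metis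
    also have "\<dots> \<le> card S" using A(2) fin by (simp only: card_mono)
    finally show ?thesis .
  qed
  ultimately show ?thesis
    by (simp add: min_anti_forcing_set_def is_arg_min_def not_less)
qed

section \<open>Intersection and union of the family from single exchanges\<close>

text \<open>If some minimum weight basis omits \<open>e\<close>, then already one exchange in
  \<open>B\<close> removes \<open>e\<close>. The intersection of a possibly exponential family is
  thereby determined by pairs of elements.\<close>

lemma min_weight_basis_diff_Inter:
  assumes B: "B \<in> min_weight_bases indep w"
  shows "B - \<Inter> (min_weight_bases indep w) =
    {e \<in> B. \<exists>f \<in> E - B. w f \<le> w e \<and> indep (insert f (B - {e}))}" (is "?L = ?R")
proof (intro subset_antisym subsetI)
  fix e assume "e \<in> ?L"
  then obtain A where A: "e \<in> B" "A \<in> min_weight_bases indep w" "e \<notin> A"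
    by (meson DiffE InterI)
  then obtain f where "f \<in> A - B" "insert f (B - {e}) \<in> min_weight_bases indep w"
    using min_weight_bases_exchange[OF B A(2), of e] by auto
  with A exchange_min_weight_iff[OF B, of e f] min_weight_basis_subset[OF A(2)]
  show "e \<in> ?R" by blast
next
  fix e assume "e \<in> ?R"
  then obtain f where f: "e \<in> B" "f \<notin> B" "insert f (B - {e}) \<in> min_weight_bases indep w"
    by (auto simp: exchange_min_weight_iff[OF B])
  then have "e \<notin> insert f (B - {e})" by auto
  with f show "e \<in> ?L" by (meson DiffI InterD)
qed

lemma Union_diff_min_weight_basis:
  assumes B: "B \<in> min_weight_bases indep w"
  shows "\<Union> (min_weight_bases indep w) - B =
    {f \<in> E - B. \<exists>e \<in> B. w f \<le> w e \<and> indep (insert f (B - {e}))}" (is "?L = ?R")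
proof (intro subset_antisym subsetI)
  fix f assume "f \<in> ?L"
  then obtain A where A: "f \<in> A" "A \<in> min_weight_bases indep w" "f \<notin> B"
    by (meson DiffE UnionE)
  then obtain e where "e \<in> B - A" "insert f (B - {e}) \<in> min_weight_bases indep w"
    using min_weight_bases_exchange[OF A(2) B, of f] by auto
  with A exchange_min_weight_iff[OF B, of e f] min_weight_basis_subset[OF A(2)]
  show "f \<in> ?R" by blast
next
  fix f assume "f \<in> ?R"
  then obtain e where "e \<in> B" "f \<notin> B" "insert f (B - {e}) \<in> min_weight_bases indep w"
    by (auto simp: exchange_min_weight_iff[OF B])
  then show "f \<in> ?L" by (meson DiffI UnionI insertI1)
qed

end

section \<open>Execution with a step bound\<close>

text \<open>Queries and other steps are counted together, since a bound on \<open>q + t\<close>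
  bounds both. As \<open>exec\<close> is deterministic, exhibiting one halting execution amounts to
  total correctness.\<close>

definition runs :: "(nat set \<Rightarrow> bool) \<Rightarrow> prog \<Rightarrow> state \<Rightarrow> nat \<Rightarrow> (state \<Rightarrow> bool) \<Rightarrow> bool" where
  "runs orc c s N Q \<longleftrightarrow> (\<exists>q t s'. exec orc c s q t s' \<and> q + t \<le> N \<and> Q s')"

abbreviation seq :: "prog \<Rightarrow> prog \<Rightarrow> prog" (infixr ";;" 60) where
  "c1 ;; c2 \<equiv> Seq c1 c2"

lemma runs_mono:
  assumes "runs orc c s M R" "M \<le> N" "\<And>s'. R s' \<Longrightarrow> Q s'"
  shows "runs orc c s N Q"
  using assms unfolding runs_def by (meson le_trans)

lemma runs_Instr: "runs orc (Instr i) s N Q \<longleftrightarrow> 1 \<le> N \<and> Q (exec_instr i s)"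
  unfolding runs_def by (fastforce elim: exec_InstrE intro: exec.Instr)

lemma runs_Query: "runs orc (Query a) s N Q \<longleftrightarrow>
    1 \<le> N \<and> Q (set_nat a (if orc (oracle_tape s) then 1 else 0) s)"
  unfolding runs_def by (fastforce elim: exec_QueryE intro: exec.Query)

lemma runs_Seq: "runs orc (c1 ;; c2) s N Q \<longleftrightarrow>
    (\<exists>q t s'. exec orc c1 s q t s' \<and> q + t \<le> N \<and> runs orc c2 s' (N - (q + t)) Q)"
proof
  assume "runs orc (c1 ;; c2) s N Q"
  then obtain q1 t1 s1 q2 t2 s2 where "exec orc c1 s q1 t1 s1" "exec orc c2 s1 q2 t2 s2"
    "q1 + q2 + (t1 + t2) \<le> N" "Q s2"
    unfolding runs_def by (blast elim: exec_SeqE)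
  then show "\<exists>q t s'. exec orc c1 s q t s' \<and> q + t \<le> N \<and> runs orc c2 s' (N - (q + t)) Q"
    unfolding runs_def by (intro exI[of _ q1] exI[of _ t1] exI[of _ s1] conjI
      exI[of _ q2] exI[of _ t2] exI[of _ s2]) auto
next
  assume "\<exists>q t s'. exec orc c1 s q t s' \<and> q + t \<le> N \<and> runs orc c2 s' (N - (q + t)) Q"
  then obtain q1 t1 s1 q2 t2 s2 where "exec orc c1 s q1 t1 s1" "exec orc c2 s1 q2 t2 s2"
    "q1 + t1 \<le> N" "q2 + t2 \<le> N - (q1 + t1)" "Q s2"
    unfolding runs_def by blast
  then show "runs orc (c1 ;; c2) s N Q"
    unfolding runs_def by (intro exI[of _ "q1 + q2"] exI[of _ "t1 + t2"] exI[of _ s2] conjI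
      exec.Seq[of orc c1 s q1 t1 s1]) auto
qed

text \<open>Composition through an intermediate assertion \<open>R\<close>, for first parts such as
  loops that are known only by a specification.\<close>

lemma runs_SeqI:
  assumes "runs orc c1 s M R" "\<And>s'. R s' \<Longrightarrow> runs orc c2 s' N Q"
  shows "runs orc (c1 ;; c2) s (M + N) Q"
proof -
  obtain q t s' where s': "exec orc c1 s q t s'" "q + t \<le> M" "R s'"
    using assms(1) unfolding runs_def by blast
  from assms(2)[OF this(3)] have "runs orc c2 s' (M + N - (q + t)) Q"
    by (rule runs_mono) (use s' in auto)
  with s' show ?thesis unfolding runs_Seq by fastforce
qed

lemma runs_If: "runs orc (If_Else b c1 c2) s N Q \<longleftrightarrow>
    0 < N \<and> (if holds b s then runs orc c1 s (N - 1) Q else runs orc c2 s (N - 1) Q)"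
  (is "?L = ?R")
proof
  assume ?L
  then show ?R unfolding runs_def by (fastforce elim: exec_If_ElseE)
next
  assume R: ?R
  then obtain q t s' where "exec orc (if holds b s then c1 else c2) s q t s'"
    "q + t \<le> N - 1" "Q s'"
    unfolding runs_def by (auto split: if_splits)
  with R show ?L
    unfolding runs_def
    by (intro exI[of _ q] exI[of _ "t + 1"] exI[of _ s'])
      (auto intro: exec.If_True[simplified] exec.If_False[simplified] split: if_splits)
qed

lemma runs_Seq_Instr: "runs orc (Instr i ;; c) s N Q \<longleftrightarrow>
    1 \<le> N \<and> runs orc c (exec_instr i s) (N - 1) Q"
  unfolding runs_Seq by (fastforce elim: exec_InstrE intro: exec.Instr)

lemma runs_Seq_Query: "runs orc (Query a ;; c) s N Q \<longleftrightarrow>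
    1 \<le> N \<and> runs orc c (set_nat a (if orc (oracle_tape s) then 1 else 0) s) (N - 1) Q"
  unfolding runs_Seq by (fastforce elim: exec_QueryE intro: exec.Query)

text \<open>The continuation moves into both branches, so that rewriting can proceed past a
  conditional.\<close>

lemma runs_Seq_If: "runs orc (If_Else b c1 c2 ;; c) s N Q \<longleftrightarrow>
    0 < N \<and> (if holds b s then runs orc (c1 ;; c) s (N - 1) Q else runs orc (c2 ;; c) s (N - 1) Q)"
  (is "?L = ?R")
proof
  assume ?L
  then show ?R unfolding runs_Seq by (fastforce elim: exec_If_ElseE)
next
  assume R: ?R
  then obtain q t s' where "exec orc (if holds b s then c1 else c2) s q t s'"
    "q + t \<le> N - 1" "runs orc c s' (N - 1 - (q + t)) Q"
    unfolding runs_Seq by (auto split: if_splits)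
  with R show ?L
    unfolding runs_Seq
    by (intro exI[of _ q] exI[of _ "t + 1"] exI[of _ s'])
      (auto intro: exec.If_True[simplified] exec.If_False[simplified] split: if_splits)
qed

text \<open>Used as rewrite rules, these equivalences execute loop-free code symbolically while
  counting down the budget.\<close>

lemmas runs_simps = runs_Instr runs_Query runs_If runs_Seq_Instr runs_Seq_Query runs_Seq_If

lemma runs_While:
  assumes "holds b s" "runs orc (c ;; While b c) s N Q"
  shows "runs orc (While b c) s (N + 1) Q"
proof -
  from assms(2) obtain q t s' where "exec orc (c ;; While b c) s q t s'" "q + t \<le> N" "Q s'"
    unfolding runs_def by blast
  with assms(1) show ?thesis
    unfolding runs_def
    by (intro exI[of _ q] exI[of _ "t + 1"] exI[of _ s'])
      (auto elim!: exec_SeqE intro: exec.While_True[simplified])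
qed

text \<open>Loops rely on cell 0 containing the size of the ground set and cell 1 containing 1.\<close>

definition For :: "nat \<Rightarrow> prog \<Rightarrow> prog" where
  "For i c = Instr (Const (Direct i) 0) ;;
     While (Less (Direct i) (Direct 0)) (c ;; Instr (Add (Direct i) (Direct i) (Direct 1)))"

text \<open>\<open>I k\<close> is the invariant at the loop head with counter \<open>k\<close>. A
  round costs \<open>M\<close> for the body, one test and one increment; the final 2 pays for the
  initialisation and the failing test.\<close>

lemma runs_For:
  assumes init: "I 0 (set_nat (Direct i) 0 s)"
    and step: "\<And>k s. k < n \<Longrightarrow> I k s \<Longrightarrow>
      runs orc c s M (\<lambda>s'. I (Suc k) (set_nat (Direct i) (nat_mem s' i + nat_mem s' 1) s'))"
    and counter: "\<And>k s. I k s \<Longrightarrow> nat_mem s 0 = n \<and> nat_mem s i = k"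
  shows "runs orc (For i c) s (n * (M + 2) + 2) (I n)"
proof -
  let ?W = "While (Less (Direct i) (Direct 0)) (c ;; Instr (Add (Direct i) (Direct i) (Direct 1)))"
  \<comment> \<open>Induction on the number \<open>d\<close> of rounds still to be done.\<close>
  have "runs orc ?W s (d * (M + 2) + 1) (I n)" if "I k s" "k + d = n" for d k s
    using that
  proof (induction d arbitrary: k s)
    case 0
    with counter[OF 0(1)] have "k = n" "\<not> holds (Less (Direct i) (Direct 0)) s" by auto
    with 0 exec.While_False show ?case unfolding runs_def by fastforce
  next
    case (Suc d)
    with counter[OF Suc(2)] have k: "k < n" and b: "holds (Less (Direct i) (Direct 0)) s" by auto
    have "runs orc (c ;; Instr (Add (Direct i) (Direct i) (Direct 1))) s (M + 1) (I (Suc k))"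
      by (rule runs_SeqI[OF step[OF k Suc(2)]]) (simp add: runs_Instr)
    from this Suc.IH have "runs orc ((c ;; Instr (Add (Direct i) (Direct i) (Direct 1))) ;; ?W) s
        (M + 1 + (d * (M + 2) + 1)) (I n)"
      by (rule runs_SeqI) (use Suc.prems in auto)
    from runs_While[OF b this] show ?case by (rule runs_mono) auto
  qed
  from this[OF init, of n] show ?thesis by (simp add: For_def runs_Seq_Instr)
qed

section \<open>The greedy algorithm and the search for exchange pairs\<close>

text \<open>\<open>P\<close> is the set of processed indices, \<open>T\<close> the set of selected ones.\<close>

definition greedy_state :: "(nat set \<Rightarrow> bool) \<Rightarrow> nat \<Rightarrow> (nat \<Rightarrow> real) \<Rightarrow> nat set \<Rightarrow> nat set \<Rightarrow> bool"
  where "greedy_state orc n v P T \<longleftrightarrow> P \<subseteq> {..<n} \<and> T \<subseteq> P \<and> orc T \<and>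
    (\<forall>j \<in> P - T. \<not> orc (insert j T)) \<and>
    (\<forall>i \<in> T. \<forall>j \<in> P - T. orc (insert j (T - {i})) \<longrightarrow> v i \<le> v j) \<and>
    (\<forall>i \<in> P. \<forall>j \<in> {..<n} - P. v i \<le> v j)"

text \<open>Processed elements weigh at most \<open>v u\<close>, so a rejected \<open>u\<close>
  cannot improve on a selected \<open>i\<close>. If \<open>u\<close> is selected, replacing it by a
  rejected \<open>j\<close> would make \<open>insert j T\<close> independent, which is excluded; the
  other pairs are inherited by downward closure.\<close>

lemma greedy_state_step:
  assumes mono: "antimono orc"
    and G: "greedy_state orc n v P T"
    and u: "u < n" "u \<notin> P" "\<forall>i<n. i \<notin> P \<longrightarrow> v u \<le> v i"
  shows "greedy_state orc n v (insert u P) (if orc (insert u T) then insert u T else T)"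
proof (cases "orc (insert u T)")
  have down: "orc Y" if "orc X" "Y \<subseteq> X" for X Y using antimonoD[OF mono that(2)] that(1) by simp
  case True
  have "v i \<le> v j" if "i \<in> insert u T" "j \<in> P - T" "orc (insert j (insert u T - {i}))" for i j
  proof (cases "i = u")
    case i: True
    with that u G have "insert u T - {i} = T" by (auto simp: greedy_state_def)
    with that G show ?thesis by (auto simp: greedy_state_def)
  next
    case False
    have "orc (insert j (T - {i}))" by (rule down[OF that(3)]) auto
    with that G False show ?thesis by (auto simp: greedy_state_def)
  qed
  moreover have "\<not> orc (insert j (insert u T))" if "j \<in> P - T" for j
    using that G down[of "insert j (insert u T)" "insert j T"] by (auto simp: greedy_state_def)
  ultimately show ?thesis using True G u by (auto simp: greedy_state_def)
next
  case False
  with G u show ?thesis by (auto simp: greedy_state_def)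
qed

text \<open>
  Cells 2 and 3 are loop counters, cell 4 holds the candidate of the greedy algorithm, cell 5 the
  oracle answer and cell 6 the address of a mark. Cell \<open>8 + i\<close> holds the mark of the element with
  index \<open>i\<close>: 0 for unprocessed, 1 for rejected and 2 for selected.
\<close>

definition layout :: "nat \<Rightarrow> nat set \<Rightarrow> nat set \<Rightarrow> (nat \<Rightarrow> nat) \<Rightarrow> bool" where
  "layout n P T m \<longleftrightarrow> m 0 = n \<and> m 1 = 1 \<and> m 7 = 8 \<and>
    (\<forall>i<n. m (8 + i) = (if i \<in> T then 2 else if i \<in> P then 1 else 0))"

lemma layout_upd: "1 < r \<Longrightarrow> r < 7 \<Longrightarrow> layout n P T (m(r := x)) \<longleftrightarrow> layout n P T m"
  by (auto simp: layout_def)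

lemma layoutD:
  assumes "layout n P T m"
  shows "m 0 = n" "m 1 = 1" "m (Suc 0) = 1" "m 7 = 8"
    "i < n \<Longrightarrow> m (8 + i) = (if i \<in> T then 2 else if i \<in> P then 1 else 0)"
  using assms by (auto simp: layout_def)

section \<open>Programs for the greedy selection and the exchange search\<close>

text \<open>Cell 7 permanently holds 8, so adding it to an index gives the address of the mark. A
  candidate not below the size of the ground set means that none has been found yet.\<close>

definition scan_body :: prog where
  "scan_body =
     Instr (Add (Direct 6) (Direct 7) (Direct 3)) ;;
     If_Else (Less (Indirect 6) (Direct 1))
       (If_Else (Less (Direct 4) (Direct 0))
         (If_Else (Real_Less (Indirect 3) (Indirect 4))
           (Instr (Move (Direct 4) (Direct 3))) (Instr Skip))
         (Instr (Move (Direct 4) (Direct 3))))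
       (Instr Skip)"

text \<open>The oracle tape always holds the selected set, and a rejected candidate is deleted
  again. One plus the oracle answer is exactly the mark: 1 for rejected, 2 for selected.\<close>

definition greedy_body :: prog where
  "greedy_body =
     Instr (Move (Direct 4) (Direct 0)) ;;
     For 3 scan_body ;;
     Instr (Add (Direct 6) (Direct 7) (Direct 4)) ;;
     Instr (Oracle_Insert (Direct 4)) ;;
     Query (Direct 5) ;;
     Instr (Add (Indirect 6) (Direct 1) (Direct 5)) ;;
     If_Else (Less (Direct 5) (Direct 1)) (Instr (Oracle_Delete (Direct 4))) (Instr Skip)"

definition greedy :: prog where
  "greedy = Instr (Const (Direct 1) 1) ;; Instr (Const (Direct 7) 8) ;; For 2 greedy_body"

text \<open>
  The parameter \<open>r\<close> is the cell whose content is output for an exchange pair: cell 2 contains the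
  element leaving the basis, cell 3 the one entering it.
\<close>

definition exchange_body :: "nat \<Rightarrow> prog" where
  "exchange_body r =
     Instr (Add (Direct 6) (Direct 7) (Direct 3)) ;;
     If_Else (Less (Direct 1) (Indirect 6)) (Instr Skip)
       (If_Else (Real_Less (Indirect 2) (Indirect 3)) (Instr Skip)
         (Instr (Oracle_Insert (Direct 3)) ;;
          Query (Direct 5) ;;
          If_Else (Less (Direct 5) (Direct 1)) (Instr Skip) (Instr (Output_Insert (Direct r))) ;;
          Instr (Oracle_Delete (Direct 3))))"

text \<open>A mark above 1 means selected. During the inner loop the tape holds the basis without
  the element in cell 2, which is restored afterwards.\<close>

definition exchange_row :: "nat \<Rightarrow> prog" where
  "exchange_row r =
     Instr (Add (Direct 6) (Direct 7) (Direct 2)) ;;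
     If_Else (Less (Direct 1) (Indirect 6))
       (Instr (Oracle_Delete (Direct 2)) ;;
        For 3 (exchange_body r) ;;
        Instr (Oracle_Insert (Direct 2)))
       (Instr Skip)"

definition exchange :: "nat \<Rightarrow> prog" where
  "exchange r = For 2 (exchange_row r)"

section \<open>Correctness and cost of the greedy selection\<close>

lemma runs_scan:
  assumes "layout n P T (nat_mem s)" "real_mem s = v" "nat_mem s 2 = k" "nat_mem s 4 = n"
    "oracle_tape s = T" "output_tape s = U" "T \<subseteq> P" "\<not> {..<n} \<subseteq> P"
  shows "runs orc (For 3 scan_body) s (n * 7 + 2) (\<lambda>s'. layout n P T (nat_mem s') \<and>
    real_mem s' = v \<and> nat_mem s' 2 = k \<and> oracle_tape s' = T \<and> output_tape s' = U \<and>
    nat_mem s' 4 < n \<and> nat_mem s' 4 \<notin> P \<and> (\<forall>i<n. i \<notin> P \<longrightarrow> v (nat_mem s' 4) \<le> v i))"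
proof -
  \<comment> \<open>Either cell 4 holds an unprocessed index that is lightest among those below
    \<open>j\<close>, or all indices below \<open>j\<close> are processed. At \<open>j = n\<close>
    the assumption \<open>\<not> {..<n} \<subseteq> P\<close> excludes the second case.\<close>
  define I where "I = (\<lambda>j (s' :: state). layout n P T (nat_mem s') \<and>
    real_mem s' = v \<and> nat_mem s' 2 = k \<and> oracle_tape s' = T \<and> output_tape s' = U \<and>
    nat_mem s' 3 = j \<and>
    (if nat_mem s' 4 < n then nat_mem s' 4 \<notin> P \<and> (\<forall>i<j. i \<notin> P \<longrightarrow> v (nat_mem s' 4) \<le> v i)
     else \<forall>i<j. i \<in> P))"
  have "runs orc (For 3 scan_body) s (n * (5 + 2) + 2) (I n)"
  proof (rule runs_For)
    show "I 0 (set_nat (Direct 3) 0 s)"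
      using assms by (simp add: I_def set_nat_def layout_upd)
  next
    fix j s assume j: "j < n" and "I j s"
    then have lay: "layout n P T (nat_mem s)" and I: "real_mem s = v" "nat_mem s 2 = k"
      "oracle_tape s = T" "output_tape s = U" "nat_mem s 3 = j"
      "if nat_mem s 4 < n then nat_mem s 4 \<notin> P \<and> (\<forall>i<j. i \<notin> P \<longrightarrow> v (nat_mem s 4) \<le> v i)
       else \<forall>i<j. i \<in> P" by (auto simp: I_def)
    note [simp] = layoutD[OF lay] layout_upd set_nat_def less_Suc_eq
    from I j lay \<open>T \<subseteq> P\<close> show "runs orc scan_body s 5
        (\<lambda>s'. I (Suc j) (set_nat (Direct 3) (nat_mem s' 3 + nat_mem s' 1) s'))"
      by (auto simp: scan_body_def runs_simps I_def split: if_splits)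
  next
    show "nat_mem s 0 = n \<and> nat_mem s 3 = j" if "I j s" for j s
      using that by (simp add: I_def layout_def)
  qed
  then show ?thesis
    by (rule runs_mono) (use assms in \<open>auto simp: I_def split: if_splits\<close>)
qed

lemma layout_mark:
  assumes "layout n P T m" "u < n" "u \<notin> T"
  shows "x = 2 \<Longrightarrow> layout n (insert u P) (insert u T) (m(8 + u := x))"
    "x = 1 \<Longrightarrow> layout n (insert u P) T (m(8 + u := x))"
  using assms by (auto simp: layout_def)

lemma runs_greedy_body:
  assumes mono: "antimono orc"
    and G: "greedy_state orc n v P T" "\<not> {..<n} \<subseteq> P"
    and s: "layout n P T (nat_mem s)" "real_mem s = v" "nat_mem s 2 = k"
      "oracle_tape s = T" "output_tape s = U"
  shows "runs orc greedy_body s (n * 7 + 9) (\<lambda>s'. \<exists>u P' T'. u < n \<and> u \<notin> P \<and> P' = insert u P \<and>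
    greedy_state orc n v P' T' \<and> layout n P' T' (nat_mem s') \<and> real_mem s' = v \<and>
    nat_mem s' 2 = k \<and> oracle_tape s' = T' \<and> output_tape s' = U)" (is "runs _ _ _ _ ?Q")
proof -
  have TP: "T \<subseteq> P" using G by (simp add: greedy_state_def)
  let ?c = "Instr (Add (Direct 6) (Direct 7) (Direct 4)) ;;
     Instr (Oracle_Insert (Direct 4)) ;;
     Query (Direct 5) ;;
     Instr (Add (Indirect 6) (Direct 1) (Direct 5)) ;;
     If_Else (Less (Direct 5) (Direct 1)) (Instr (Oracle_Delete (Direct 4))) (Instr Skip)"
  have rest: "runs orc ?c s 6 ?Q" if lay: "layout n P T (nat_mem s)" and
    s: "real_mem s = v" "nat_mem s 2 = k" "oracle_tape s = T" "output_tape s = U"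
    and u: "nat_mem s 4 < n" "nat_mem s 4 \<notin> P"
      "\<forall>i<n. i \<notin> P \<longrightarrow> v (nat_mem s 4) \<le> v i" for s
  proof -
    note [simp] = layoutD[OF lay] layout_upd set_nat_def
    \<comment> \<open>Hence deleting a rejected candidate from the tape gives back exactly
      \<open>T\<close>.\<close>
    have "nat_mem s 4 \<notin> T" using u TP by auto
    note facts = this greedy_state_step[OF mono G(1) u] u lay s
    show ?thesis
    proof (cases "orc (insert (nat_mem s 4) T)")
      case True
      with facts show ?thesis
        by (auto simp: runs_simps intro!: exI[of _ "nat_mem s 4"] layout_mark(1))
    next
      case False
      with facts show ?thesis
        by (auto simp: runs_simps intro!: exI[of _ "nat_mem s 4"] layout_mark(2))
    qed
  qed
  have "runs orc (For 3 scan_body ;; ?c) (exec_instr (Move (Direct 4) (Direct 0)) s)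
    (n * 7 + 2 + 6) ?Q"
    using G s TP
    by (intro runs_SeqI[OF runs_scan rest])
      (auto simp: set_nat_def layout_upd layoutD)
  then show ?thesis by (simp add: greedy_body_def runs_Seq_Instr add.commute)
qed

lemma runs_greedy:
  assumes mono: "antimono orc" and "orc {}"
    and s: "nat_mem s = (\<lambda>_. 0)(0 := n)" "real_mem s = v" "oracle_tape s = {}" "output_tape s = {}"
  shows "runs orc greedy s (n * (n * 7 + 11) + 4) (\<lambda>s'. \<exists>T. greedy_state orc n v {..<n} T \<and>
    layout n {..<n} T (nat_mem s') \<and> real_mem s' = v \<and> oracle_tape s' = T \<and> output_tape s' = {})"
proof -
  \<comment> \<open>Ties may be broken in any way, so \<open>P\<close> is known only by its
    cardinality \<open>k\<close>; at the end \<open>card P = n\<close> forces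
    \<open>P = {..<n}\<close>.\<close>
  define I where "I = (\<lambda>k (s' :: state). \<exists>P T. card P = k \<and> greedy_state orc n v P T \<and>
    layout n P T (nat_mem s') \<and> real_mem s' = v \<and> nat_mem s' 2 = k \<and> oracle_tape s' = T \<and>
    output_tape s' = {})"
  let ?s = "exec_instr (Const (Direct 7) 8) (exec_instr (Const (Direct 1) 1) s)"
  have "runs orc (For 2 greedy_body) ?s (n * (n * 7 + 9 + 2) + 2) (I n)"
  proof (rule runs_For)
    have "greedy_state orc n v {} {}" using \<open>orc {}\<close> by (simp add: greedy_state_def)
    moreover have "layout n {} {} (nat_mem (set_nat (Direct 2) 0 ?s))"
      by (simp add: layout_def set_nat_def s)
    ultimately show "I 0 (set_nat (Direct 2) 0 ?s)"
      using s by (auto simp: I_def set_nat_def intro!: exI[of _ "{}"])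
  next
    fix k s assume k: "k < n" and "I k s"
    then obtain P T where P: "card P = k" and I: "greedy_state orc n v P T"
      "layout n P T (nat_mem s)" "real_mem s = v" "nat_mem s 2 = k" "oracle_tape s = T"
      "output_tape s = {}" by (auto simp: I_def)
    have "finite P" using I(1) by (auto simp: greedy_state_def intro: finite_subset)
    with P k have "\<not> {..<n} \<subseteq> P" using card_mono[of P "{..<n}"] by auto
    from runs_greedy_body[OF mono I(1) this I(2-6)]
    show "runs orc greedy_body s (n * 7 + 9)
        (\<lambda>s'. I (Suc k) (set_nat (Direct 2) (nat_mem s' 2 + nat_mem s' 1) s'))"
    proof (rule runs_mono)
      fix s' :: state assume "\<exists>u P' T'. u < n \<and> u \<notin> P \<and> P' = insert u P \<and>
        greedy_state orc n v P' T' \<and> layout n P' T' (nat_mem s') \<and> real_mem s' = v \<and>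
        nat_mem s' 2 = k \<and> oracle_tape s' = T' \<and> output_tape s' = {}"
      then obtain u where "u \<notin> P" "greedy_state orc n v (insert u P) (oracle_tape s')"
        "layout n (insert u P) (oracle_tape s') (nat_mem s')" "real_mem s' = v"
        "nat_mem s' 2 = k" "output_tape s' = {}" by blast
      with \<open>finite P\<close> P show "I (Suc k) (set_nat (Direct 2) (nat_mem s' 2 + nat_mem s' 1) s')"
        by (auto simp: I_def set_nat_def layout_upd layoutD intro!: exI[of _ "insert u P"])
    qed simp
  next
    show "nat_mem s 0 = n \<and> nat_mem s 2 = k" if "I k s" for k s
      using that by (auto simp: I_def layout_def)
  qed
  moreover have "\<exists>T. greedy_state orc n v {..<n} T \<and> layout n {..<n} T (nat_mem s') \<and>
    real_mem s' = v \<and> oracle_tape s' = T \<and> output_tape s' = {}" if "I n s'" for s'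
  proof -
    from that obtain P where P: "card P = n" "greedy_state orc n v P (oracle_tape s')"
      "layout n P (oracle_tape s') (nat_mem s')" "real_mem s' = v" "output_tape s' = {}"
      by (auto simp: I_def)
    then have "P = {..<n}" by (intro card_subset_eq) (auto simp: greedy_state_def)
    with P show ?thesis by auto
  qed
  ultimately have "runs orc (For 2 greedy_body) ?s (n * (n * 7 + 9 + 2) + 2)
    (\<lambda>s'. \<exists>T. greedy_state orc n v {..<n} T \<and>
    layout n {..<n} T (nat_mem s') \<and> real_mem s' = v \<and> oracle_tape s' = T \<and> output_tape s' = {})"
    by (rule runs_mono[OF _ order_refl])
  then show ?thesis by (simp add: greedy_def runs_Seq_Instr add.commute)
qed

section \<open>Correctness and cost of the exchange search\<close>

definition exchange_pairs :: "(nat set \<Rightarrow> bool) \<Rightarrow> nat \<Rightarrow> (nat \<Rightarrow> real) \<Rightarrow> nat set \<Rightarrow> (nat \<times> nat) set"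
  where "exchange_pairs orc n v T =
    {(i, j). i \<in> T \<and> j \<in> {..<n} - T \<and> v j \<le> v i \<and> orc (insert j (T - {i}))}"

lemma runs_exchange_body:
  assumes r: "r \<in> {2, 3}" and i: "i < n" "i \<in> T" and j: "j < n"
    and lay: "layout n {..<n} T (nat_mem s)" and s: "real_mem s = v" "nat_mem s 2 = i"
      "nat_mem s 3 = j" "oracle_tape s = T - {i}" "output_tape s = U"
  shows "runs orc (exchange_body r) s 8 (\<lambda>s'. layout n {..<n} T (nat_mem s') \<and> real_mem s' = v \<and>
    nat_mem s' 2 = i \<and> nat_mem s' 3 = j \<and> oracle_tape s' = T - {i} \<and>
    output_tape s' =
      U \<union> (if (i, j) \<in> exchange_pairs orc n v T then {if r = 2 then i else j} else {}))"
proof -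
  note [simp] = layoutD[OF lay] layout_upd set_nat_def
  show ?thesis
  proof (cases "j \<in> T \<or> v i < v j")
    case True
    then have "(i, j) \<notin> exchange_pairs orc n v T" by (auto simp: exchange_pairs_def)
    with True i j lay s show ?thesis by (auto simp: exchange_body_def runs_simps)
  next
    case False
    \<comment> \<open>The deletion after the query restores the tape because \<open>j\<close> is not
      in \<open>T\<close>.\<close>
    then have "insert j (T - {i}) - {j} = T - {i}"
      "(i, j) \<in> exchange_pairs orc n v T \<longleftrightarrow> orc (insert j (T - {i}))"
      using i j by (auto simp: exchange_pairs_def)
    moreover have "r = 3" if "r \<noteq> 2" using r that by simp
    ultimately show ?thesis using False i j lay s
      by (cases "orc (insert j (T - {i}))"; cases "r = 2") (simp_all add: exchange_body_def runs_simps)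
  qed
qed

lemma runs_exchange_row:
  assumes r: "r \<in> {2, 3}" and i: "i < n"
    and lay: "layout n {..<n} T (nat_mem s)" and s: "real_mem s = v" "nat_mem s 2 = i"
      "oracle_tape s = T" "output_tape s = U"
  shows "runs orc (exchange_row r) s (n * 10 + 6) (\<lambda>s'. layout n {..<n} T (nat_mem s') \<and>
    real_mem s' = v \<and> nat_mem s' 2 = i \<and> oracle_tape s' = T \<and>
    output_tape s' = U \<union> {if r = 2 then i else j | j. (i, j) \<in> exchange_pairs orc n v T})"
    (is "runs _ _ _ _ ?Q")
proof (cases "i \<in> T")
  case False
  note [simp] = layoutD[OF lay] layout_upd set_nat_def
  from False i lay s show ?thesis
    by (auto simp: exchange_row_def runs_simps exchange_pairs_def)
next
  case True
  let ?R = "exchange_pairs orc n v T"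
  define I where "I = (\<lambda>j (s' :: state). layout n {..<n} T (nat_mem s') \<and> real_mem s' = v \<and>
    nat_mem s' 2 = i \<and> nat_mem s' 3 = j \<and> oracle_tape s' = T - {i} \<and>
    output_tape s' = U \<union> {if r = 2 then i else j' | j'. j' < j \<and> (i, j') \<in> ?R})"
  let ?s = "exec_instr (Oracle_Delete (Direct 2)) (exec_instr (Add (Direct 6) (Direct 7) (Direct 2)) s)"
  have "runs orc (For 3 (exchange_body r)) ?s (n * (8 + 2) + 2) (I n)"
  proof (rule runs_For)
    show "I 0 (set_nat (Direct 3) 0 ?s)"
      using lay s by (simp add: I_def set_nat_def layout_upd)
  next
    fix j s assume j: "j < n" and "I j s"
    then have I: "layout n {..<n} T (nat_mem s)" "real_mem s = v" "nat_mem s 2 = i"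
      "nat_mem s 3 = j" "oracle_tape s = T - {i}"
      "output_tape s = U \<union> {if r = 2 then i else j' | j'. j' < j \<and> (i, j') \<in> ?R}"
      by (simp_all add: I_def)
    from runs_exchange_body[OF r i True j this]
    show "runs orc (exchange_body r) s 8
        (\<lambda>s'. I (Suc j) (set_nat (Direct 3) (nat_mem s' 3 + nat_mem s' 1) s'))"
      by (rule runs_mono) (auto simp: I_def set_nat_def layout_upd layoutD less_Suc_eq)
  next
    show "nat_mem s 0 = n \<and> nat_mem s 3 = j" if "I j s" for j s
      using that by (auto simp: I_def layout_def)
  qed
  moreover have "runs orc (Instr (Oracle_Insert (Direct 2))) s' 1 ?Q" if "I n s'" for s'
  proof -
    \<comment> \<open>The bound on \<open>j'\<close> left in the invariant is harmless at the end,
      as entering elements are below \<open>n\<close> by definition.\<close>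
    have "j < n \<and> (i, j) \<in> ?R \<longleftrightarrow> (i, j) \<in> ?R" for j by (auto simp: exchange_pairs_def)
    with that True show ?thesis by (simp add: I_def runs_Instr insert_absorb)
  qed
  ultimately have "runs orc (For 3 (exchange_body r) ;; Instr (Oracle_Insert (Direct 2))) ?s
    (n * (8 + 2) + 2 + 1) ?Q" by (rule runs_SeqI)
  then have "runs orc (For 3 (exchange_body r) ;; Instr (Oracle_Insert (Direct 2))) ?s
    (3 + n * 10) ?Q" by (rule runs_mono) auto
  moreover have "runs orc (exchange_row r) s (n * 10 + 6) Q"
    if "runs orc (For 3 (exchange_body r) ;; Instr (Oracle_Insert (Direct 2))) ?s (3 + n * 10) Q" for Q
    using that True i lay s by (simp add: exchange_row_def runs_simps set_nat_def layoutD)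
  ultimately show ?thesis by blast
qed

lemma runs_exchange:
  assumes r: "r \<in> {2, 3}"
    and lay: "layout n {..<n} T (nat_mem s)" and s: "real_mem s = v"
      "oracle_tape s = T" "output_tape s = {}" and T: "T \<subseteq> {..<n}"
  shows "runs orc (exchange r) s (n * (n * 10 + 8) + 2) (\<lambda>s'.
    output_tape s' = {if r = 2 then i else j | i j. (i, j) \<in> exchange_pairs orc n v T})"
proof -
  let ?R = "exchange_pairs orc n v T"
  define I where "I = (\<lambda>i (s' :: state). layout n {..<n} T (nat_mem s') \<and> real_mem s' = v \<and>
    nat_mem s' 2 = i \<and> oracle_tape s' = T \<and>
    output_tape s' = {if r = 2 then i' else j | i' j. i' < i \<and> (i', j) \<in> ?R})"
  have "runs orc (For 2 (exchange_row r)) s (n * (n * 10 + 6 + 2) + 2) (I n)"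
  proof (rule runs_For)
    show "I 0 (set_nat (Direct 2) 0 s)"
      using lay s by (simp add: I_def set_nat_def layout_upd)
  next
    fix i s assume i: "i < n" and "I i s"
    then have I: "layout n {..<n} T (nat_mem s)" "real_mem s = v" "nat_mem s 2 = i"
      "oracle_tape s = T"
      "output_tape s = {if r = 2 then i' else j | i' j. i' < i \<and> (i', j) \<in> ?R}"
      by (simp_all add: I_def)
    from runs_exchange_row[OF r i this]
    show "runs orc (exchange_row r) s (n * 10 + 6)
        (\<lambda>s'. I (Suc i) (set_nat (Direct 2) (nat_mem s' 2 + nat_mem s' 1) s'))"
      by (rule runs_mono) (auto simp: I_def set_nat_def layout_upd layoutD less_Suc_eq)
  next
    show "nat_mem s 0 = n \<and> nat_mem s 2 = i" if "I i s" for i s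
      using that by (auto simp: I_def layout_def)
  qed
  moreover have "i < n \<and> (i, j) \<in> ?R \<longleftrightarrow> (i, j) \<in> ?R" for i j
    using T by (auto simp: exchange_pairs_def)
  ultimately show ?thesis
    unfolding exchange_def by (elim runs_mono) (simp_all add: I_def)
qed

lemma runs_greedy_exchange:
  assumes mono: "antimono orc" and "orc {}"
    and s: "nat_mem s = (\<lambda>_. 0)(0 := n)" "real_mem s = v" "oracle_tape s = {}" "output_tape s = {}"
    and r: "r \<in> {2, 3}"
  shows "runs orc (greedy ;; exchange r) s (n * (n * 17 + 19) + 6) (\<lambda>s'. \<exists>T.
    greedy_state orc n v {..<n} T \<and>
    output_tape s' = {if r = 2 then i else j | i j. (i, j) \<in> exchange_pairs orc n v T})"
proof -
  have "runs orc (greedy ;; exchange r) s (n * (n * 7 + 11) + 4 + (n * (n * 10 + 8) + 2)) (\<lambda>s'. \<exists>T.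
    greedy_state orc n v {..<n} T \<and>
    output_tape s' = {if r = 2 then i else j | i j. (i, j) \<in> exchange_pairs orc n v T})"
  proof (rule runs_SeqI[OF runs_greedy[OF assms(1-6)]])
    fix s' :: state assume "\<exists>T. greedy_state orc n v {..<n} T \<and> layout n {..<n} T (nat_mem s') \<and>
      real_mem s' = v \<and> oracle_tape s' = T \<and> output_tape s' = {}"
    then obtain T where T: "greedy_state orc n v {..<n} T" "layout n {..<n} T (nat_mem s')"
      "real_mem s' = v" "oracle_tape s' = T" "output_tape s' = {}" by blast
    then have "T \<subseteq> {..<n}" by (simp add: greedy_state_def)
    from runs_exchange[OF r T(2-5) this, of orc]
    show "runs orc (exchange r) s' (n * (n * 10 + 8) + 2) (\<lambda>s'. \<exists>T.
      greedy_state orc n v {..<n} T \<and>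
      output_tape s' = {if r = 2 then i else j | i j. (i, j) \<in> exchange_pairs orc n v T})"
      by (rule runs_mono) (use T(1) in auto)
  qed
  then show ?thesis by (simp add: algebra_simps)
qed

section \<open>From indices to elements\<close>

lemma antimono_indep_oracle: "matroid E indep \<Longrightarrow> antimono (indep_oracle indep xs)"
  by (rule antimonoI) (auto simp: indep_oracle_def intro: matroid.indep_subset[OF _ _ image_mono])

text \<open>Distinctness makes \<open>nth\<close> injective on the indices, so that removing an
  index removes exactly its element.\<close>

lemma indep_oracle_exchange:
  assumes "distinct xs" "T \<subseteq> {..<length xs}" "i \<in> T" "j \<in> {..<length xs} - T"
  shows "indep_oracle indep xs (insert j (T - {i})) \<longleftrightarrow>
    indep (insert (xs ! j) ((!) xs ` T - {xs ! i}))"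
proof -
  have "inj_on ((!) xs) {..<length xs}" using assms(1) by (simp add: inj_on_nth)
  then have "(!) xs ` (T - {i}) = (!) xs ` T - {xs ! i}"
    using assms inj_on_image_set_diff[of "(!) xs" "{..<length xs}" T "{i}"] by auto
  with assms show ?thesis by (auto simp: indep_oracle_def)
qed

lemma image_nth_lessThan: "(!) xs ` {..<length xs} = set xs"
  by (auto simp: set_conv_nth)

lemma image_nth_Diff:
  assumes "distinct xs" "T \<subseteq> {..<length xs}"
  shows "(!) xs ` ({..<length xs} - T) = set xs - (!) xs ` T"
  using inj_on_image_set_diff[of "(!) xs" "{..<length xs}" "{..<length xs}" T] assms
  by (simp add: inj_on_nth image_nth_lessThan)

lemma image_fst_Collect: "fst ` {(a, b). Q a b} = {a. \<exists>b. Q a b}"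
  by force

lemma image_snd_Collect: "snd ` {(a, b). Q a b} = {b. \<exists>a. Q a b}"
  by force

section \<open>The greedy result read as a set of elements\<close>

text \<open>\<open>v\<close> stands for the contents of the real memory and is required to agree
  with the weights only at valid indices.\<close>

context
  fixes E :: "'a set" and indep :: "'a set \<Rightarrow> bool" and w :: "'a \<Rightarrow> real" and xs :: "'a list"
    and v :: "nat \<Rightarrow> real" and T :: "nat set"
  assumes M: "matroid E indep" and xs: "distinct xs" "set xs = E"
    and v: "\<And>i. i < length xs \<Longrightarrow> v i = w (xs ! i)"
    and greedy: "greedy_state (indep_oracle indep xs) (length xs) v {..<length xs} T"
begin

interpretation matroid E indep by (rule M)

private lemma T: "T \<subseteq> {..<length xs}"
  using greedy by (simp add: greedy_state_def)

text \<open>Once all indices are processed, rejected elements cannot be added, which gives a basis,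
  and no exchange with a rejected element is lighter, which gives local optimality.\<close>

lemma greedy_min_weight_basis: "(!) xs ` T \<in> min_weight_bases indep w"
proof (rule locally_optimal_basis)
  let ?B = "(!) xs ` T"
  have "indep ?B" using greedy by (simp add: greedy_state_def indep_oracle_def)
  moreover have "X = ?B" if X: "indep X" "?B \<subseteq> X" for X
  proof (rule ccontr)
    assume "X \<noteq> ?B"
    with X indep_subset_ground obtain f where f: "f \<in> E - ?B" "f \<in> X" by blast
    then obtain j where j: "j \<in> {..<length xs} - T" "f = xs ! j"
      using image_nth_Diff[OF xs(1) T] xs(2) by blast
    with X f have "indep (insert f ?B)" by (meson indep_subset insert_subset)
    with j T have "indep_oracle indep xs (insert j T)" by (simp add: indep_oracle_def)
    with j greedy show False by (auto simp: greedy_state_def)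
  qed
  ultimately show "basis indep ?B" by (simp add: basis_def)
next
  fix e f assume ef: "e \<in> (!) xs ` T" "f \<in> E - (!) xs ` T" "indep (insert f ((!) xs ` T - {e}))"
  then obtain i j where i: "i \<in> T" "e = xs ! i" and j: "j \<in> {..<length xs} - T" "f = xs ! j"
    using image_nth_Diff[OF xs(1) T] xs(2) by blast
  with ef indep_oracle_exchange[OF xs(1) T i(1) j(1)]
  have "indep_oracle indep xs (insert j (T - {i}))" by simp
  with i j greedy have "v i \<le> v j" by (simp add: greedy_state_def)
  with i j T show "w e \<le> w f" by (simp add: v subset_iff)
qed

text \<open>Translates the pairs found by the machine into the pairs of the exchange
  characterisation; their two projections are the required sets.\<close>

lemma image_exchange_pairs:
  "map_prod ((!) xs) ((!) xs) ` exchange_pairs (indep_oracle indep xs) (length xs) v T =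
    {(e, f). e \<in> (!) xs ` T \<and> f \<in> E - (!) xs ` T \<and> w f \<le> w e \<and>
      indep (insert f ((!) xs ` T - {e}))}" (is "_ ` ?P = ?R")
proof -
  have iff: "(i, j) \<in> ?P \<longleftrightarrow> (xs ! i, xs ! j) \<in> ?R" if ij: "i \<in> T" "j \<in> {..<length xs} - T" for i j
  proof -
    have "xs ! j \<in> E - (!) xs ` T" using ij image_nth_Diff[OF xs(1) T] xs(2) by blast
    with ij T show ?thesis
      using indep_oracle_exchange[OF xs(1) T ij] by (auto simp: exchange_pairs_def v subset_iff)
  qed
  show ?thesis
  proof (intro subset_antisym subsetI)
    fix x assume "x \<in> map_prod ((!) xs) ((!) xs) ` ?P"
    then obtain i j where "(i, j) \<in> ?P" "x = (xs ! i, xs ! j)" by auto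
    moreover from this(1) have "i \<in> T" "j \<in> {..<length xs} - T" by (auto simp: exchange_pairs_def)
    ultimately show "x \<in> ?R" using iff[of i j] by simp
  next
    fix x assume x: "x \<in> ?R"
    then obtain e f where ef: "x = (e, f)" "e \<in> (!) xs ` T" "f \<in> E - (!) xs ` T" by auto
    then have "f \<in> (!) xs ` ({..<length xs} - T)"
      using image_nth_Diff[OF xs(1) T] xs(2) by simp
    with ef obtain i j where ij: "i \<in> T" "j \<in> {..<length xs} - T" and "x = (xs ! i, xs ! j)"
      by (elim imageE) simp
    with iff[OF ij] x show "x \<in> map_prod ((!) xs) ((!) xs) ` ?P"
      by (intro image_eqI[of _ _ "(i, j)"]) simp_all
  qed
qed

lemma min_forcing_set_fst_exchange_pairs:
  "min_forcing_set E indep w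
    ((!) xs ` fst ` exchange_pairs (indep_oracle indep xs) (length xs) v T)"
proof -
  let ?B = "(!) xs ` T"
  have "(!) xs ` fst ` exchange_pairs (indep_oracle indep xs) (length xs) v T =
    fst ` map_prod ((!) xs) ((!) xs) ` exchange_pairs (indep_oracle indep xs) (length xs) v T"
    by (simp add: image_image)
  also have "\<dots> = {e \<in> ?B. \<exists>f \<in> E - ?B. w f \<le> w e \<and> indep (insert f (?B - {e}))}"
    unfolding image_exchange_pairs image_fst_Collect by blast
  also have "\<dots> = ?B - \<Inter> (min_weight_bases indep w)"
    by (simp add: min_weight_basis_diff_Inter greedy_min_weight_basis)
  finally show ?thesis
    using min_forcing_set_min_weight_basis greedy_min_weight_basis by simp
qed

lemma min_anti_forcing_set_snd_exchange_pairs: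
  "min_anti_forcing_set E indep w
    ((!) xs ` snd ` exchange_pairs (indep_oracle indep xs) (length xs) v T)"
proof -
  let ?B = "(!) xs ` T"
  have "(!) xs ` snd ` exchange_pairs (indep_oracle indep xs) (length xs) v T =
    snd ` map_prod ((!) xs) ((!) xs) ` exchange_pairs (indep_oracle indep xs) (length xs) v T"
    by (simp add: image_image)
  also have "\<dots> = {f \<in> E - ?B. \<exists>e \<in> ?B. w f \<le> w e \<and> indep (insert f (?B - {e}))}"
    unfolding image_exchange_pairs image_snd_Collect by blast
  also have "\<dots> = \<Union> (min_weight_bases indep w) - ?B"
    by (simp add: Union_diff_min_weight_basis greedy_min_weight_basis)
  finally show ?thesis
    using min_anti_forcing_set_min_weight_basis greedy_min_weight_basis by simp
qed

end

section \<open>The polynomial time bound for both problems\<close>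

lemma poly_time_computable_exchange:
  fixes solution :: "'a set \<Rightarrow> ('a set \<Rightarrow> bool) \<Rightarrow> ('a \<Rightarrow> real) \<Rightarrow> 'a set \<Rightarrow> bool"
    and r :: nat
  assumes r: "r \<in> {2, 3}"
    and solution: "\<And>E indep w xs v T. matroid E indep \<Longrightarrow> distinct xs \<Longrightarrow> set xs = E \<Longrightarrow>
      (\<And>i. i < length xs \<Longrightarrow> v i = w (xs ! i)) \<Longrightarrow>
      greedy_state (indep_oracle indep xs) (length xs) v {..<length xs} T \<Longrightarrow>
      solution E indep w
        ((!) xs ` (if r = 2 then fst else snd) ` exchange_pairs (indep_oracle indep xs) (length xs) v T)"
  shows "poly_time_computable solution"
  unfolding poly_time_computable_def
\<comment> \<open>The coefficients, constant term first, are those of the bound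
  \<open>n * (n * 17 + 19) + 6\<close> on queries and steps together.\<close>
proof (rule exI[of _ "greedy ;; exchange r"], rule exI[of _ "[:6, 19, 17:]"], intro allI impI)
  fix E indep w and xs :: "'a list"
  assume M: "matroid E indep" and xs: "distinct xs" "set xs = E"
  let ?n = "length xs" and ?orc = "indep_oracle indep xs" and ?s = "initial_state w xs"
  have n: "card E = ?n" using xs distinct_card by blast
  have "?orc {}" using M by (simp add: indep_oracle_def matroid.indep_empty)
  from runs_greedy_exchange[OF antimono_indep_oracle[OF M] this _ refl _ _ r, of ?s ?n]
  obtain q t s' T where ex: "exec ?orc (greedy ;; exchange r) ?s q t s'"
    and qt: "q + t \<le> ?n * (?n * 17 + 19) + 6"
    and T: "greedy_state ?orc ?n (real_mem ?s) {..<?n} T"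
    and out: "output_tape s' =
      {if r = 2 then i else j | i j. (i, j) \<in> exchange_pairs ?orc ?n (real_mem ?s) T}"
    unfolding runs_def by (auto simp: initial_state_def)
  let ?P = "exchange_pairs ?orc ?n (real_mem ?s) T"
  have out: "output_tape s' = (if r = 2 then fst else snd) ` ?P"
    unfolding out by force
  have "T \<subseteq> {..<?n}" using T by (simp add: greedy_state_def)
  then have "output_tape s' \<subseteq> {..<?n}" unfolding out by (auto simp: exchange_pairs_def)
  moreover have "solution E indep w ((!) xs ` output_tape s')"
    unfolding out by (rule solution[OF M xs _ T]) (simp add: initial_state_def)
  moreover have "q \<le> poly [:6, 19, 17:] (card E)" "t \<le> poly [:6, 19, 17:] (card E)"
    using qt by (simp_all add: n algebra_simps)
  ultimately show "\<exists>q t s. exec ?orc (greedy ;; exchange r) ?s q t s \<and>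
      q \<le> poly [:6, 19, 17:] (card E) \<and> t \<le> poly [:6, 19, 17:] (card E) \<and>
      output_tape s \<subseteq> {..<?n} \<and> solution E indep w ((!) xs ` output_tape s)"
    using ex by blast
qed

theorem theorem6:
  shows "poly_time_computable
           (min_forcing_set :: 'a set \<Rightarrow> ('a set \<Rightarrow> bool) \<Rightarrow> ('a \<Rightarrow> real) \<Rightarrow> 'a set \<Rightarrow> bool) \<and>
         poly_time_computable
           (min_anti_forcing_set :: 'a set \<Rightarrow> ('a set \<Rightarrow> bool) \<Rightarrow> ('a \<Rightarrow> real) \<Rightarrow> 'a set \<Rightarrow> bool)"
proof
  show "poly_time_computable
    (min_forcing_set :: 'a set \<Rightarrow> ('a set \<Rightarrow> bool) \<Rightarrow> ('a \<Rightarrow> real) \<Rightarrow> 'a set \<Rightarrow> bool)"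
    \<comment> \<open>Cell 2 holds the leaving elements, which form the forcing set; cell 3 below
      holds the entering ones, which form the anti-forcing set.\<close>
    by (rule poly_time_computable_exchange[of 2])
      (simp_all add: min_forcing_set_fst_exchange_pairs)
  show "poly_time_computable
    (min_anti_forcing_set :: 'a set \<Rightarrow> ('a set \<Rightarrow> bool) \<Rightarrow> ('a \<Rightarrow> real) \<Rightarrow> 'a set \<Rightarrow> bool)"
    by (rule poly_time_computable_exchange[of 3])
      (simp_all add: min_anti_forcing_set_snd_exchange_pairs)
qed

end
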